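(* Let $n$ be a positive integer. Then the following three identities hold (as identities of rational functions in the independent variables $x,y$; equivalently, for all complex numbers $x\neq y$): $$\sum_{k=0}^nE_k(x)E_{n-k}(y)-\frac{4}{n+2}\cdot\frac{B_{n+2}(x)-B_{n+2}(y)}{x-y}=-2\sum_{l=0}^{n+1}\binom{n+1}{l}\frac{E_l(x-y)B_{n+1-l}(y)+E_l(y-x)B_{n+1-l}(x)}{l+1};$$ $$\sum_{k=1}^n\frac{B_k(x)}{k}E_{n-k}(y)-H_nE_n(y)-\frac{E_n(x)-E_n(y)}{x-y}=\sum_{l=1}^n\binom{n}{l}\left(\frac{B_l(x-y)}{l}E_{n-l}(y)-\frac{E_{l-1}(y-x)}{2}E_{n-l}(x)\right);$$ and $$\sum_{k=0}^nB_k(x)E_{n-k}(y)=\sum_{l=1}^n\binom{n+1}{l+1}\left(B_l(x-y)E_{n-l}(y)-\frac{E_{l-1}(y-x)}{2}E_{n-l}(x)\right)+(n+1)\left(\frac{E_n(x)}{x-y}+E_n(y)\right)-\frac{E_{n+1}(x)-E_{n+1}(y)}{(x-y)^2}.$$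
   Context: The Bernoulli numbers $B_0,B_1,\ldots$ are defined by $\frac{z}{e^z-1}=\sum_{n=0}^{\infty}B_n\frac{z^n}{n!}$ for $|z|<2\pi$ (so $B_1=-1/2$). The Bernoulli polynomials are $B_n(x)=\sum_{k=0}^n\binom{n}{k}B_kx^{n-k}$ for $n=0,1,2,\ldots$. The Euler polynomials $E_n(x)$ ($n=0,1,2,\ldots$) are defined by $\frac{2e^{xz}}{e^z+1}=\sum_{n=0}^{\infty}E_n(x)\frac{z^n}{n!}$. For a positive integer $n$, $H_n=1+\frac12+\cdots+\frac1n$. *)

theory Defs
  imports "HOL-Complex_Analysis.Complex_Analysis"
begin

text \<open>
  The generating series are formal power series in \<open>z\<close>. The lemmas below show that they are the
  expansions at \<open>0\<close> of the analytic generating functions.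
\<close>

definition bernoulli_number :: "nat \<Rightarrow> complex" where
  "bernoulli_number n = fact n * fps_nth (fps_X / (fps_exp 1 - 1)) n"

definition bernoulli_polynomial :: "nat \<Rightarrow> complex \<Rightarrow> complex" where
  "bernoulli_polynomial n x =
     (\<Sum>k=0..n. of_nat (n choose k) * bernoulli_number k * x ^ (n - k))"

definition euler_polynomial :: "nat \<Rightarrow> complex \<Rightarrow> complex" where
  "euler_polynomial n x = fact n * fps_nth (2 * fps_exp x / (fps_exp 1 + 1)) n"

lemma subdegree_1_minus_fps_exp: "subdegree (1 - fps_exp 1 :: complex fps) = Suc 0"
  by (rule subdegreeI) auto

lemma bernoulli_number_generating_function:
  "(\<lambda>z::complex. if z = 0 then 1 else z / (exp z - 1)) has_fps_expansion
     Abs_fps (\<lambda>n. bernoulli_number n / fact n)"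
proof -
  have "(\<lambda>z::complex. if z = 0 then
            fps_nth (fps_X :: complex fps) 1 / fps_nth (fps_exp 1 - 1 :: complex fps) 1
          else z / (exp (1 * z) - 1)) has_fps_expansion (fps_X / (fps_exp 1 - 1))"
    by (rule has_fps_expansion_divide)
       (auto intro!: fps_expansion_intros simp: subdegree_1_minus_fps_exp
             simp del: mult_1_left)
  moreover have "Abs_fps (\<lambda>n. bernoulli_number n / fact n) = fps_X / (fps_exp 1 - 1)"
    by (simp add: fps_eq_iff bernoulli_number_def)
  ultimately show ?thesis by (simp cong: if_cong)
qed

lemma euler_polynomial_generating_function:
  "(\<lambda>z. 2 * exp (x * z) / (exp z + 1)) has_fps_expansion
     Abs_fps (\<lambda>n. euler_polynomial n x / fact n)"
proof -
  have "(\<lambda>z. 2 * exp (x * z) / (exp (1 * z) + 1)) has_fps_expansion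
          (2 * fps_exp x / (fps_exp 1 + 1))"
    by (rule has_fps_expansion_divide')
       (auto intro!: fps_expansion_intros simp del: mult_1_left)
  moreover have "Abs_fps (\<lambda>n. euler_polynomial n x / fact n) = 2 * fps_exp x / (fps_exp 1 + 1)"
    by (simp add: fps_eq_iff euler_polynomial_def)
  ultimately show ?thesis by simp
qed

end

theory Submission
  imports Defs
begin

text \<open>
  Write \<open>E(x, z) = 2 e\<^sup>x\<^sup>z / (e\<^sup>z + 1)\<close> and \<open>B(x, z) = z e\<^sup>x\<^sup>z / (e\<^sup>z - 1)\<close> for the generating
  functions. The sums over \<open>k\<close> on the left-hand sides carry no binomial coefficients. They appear
  when a parameter \<open>t\<close> is introduced and integrated away, because
  \<open>(n + 1) (n choose k) \<integral> t\<^sup>k (1 - t)\<^sup>n\<^sup>-\<^sup>k dt = 1\<close> over \<open>[0, 1]\<close>: the sum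
  \<open>\<Sum>k. E\<^sub>k(x) E\<^sub>n\<^sub>-\<^sub>k(y)\<close> is the integral of \<open>(n + 1)!\<close> times the coefficient of \<open>z\<^sup>n\<close> in
  \<open>E(x, t z) E(y, (1 - t) z)\<close>, and similarly for \<open>B(x, t z) E(y, (1 - t) z)\<close>.

  With \<open>a = e\<^sup>t\<^sup>z\<close> and \<open>b = e\<^sup>(\<^sup>1\<^sup>-\<^sup>t\<^sup>)\<^sup>z\<close>, so that \<open>a b = e\<^sup>z\<close> does not depend on \<open>t\<close>, these two products
  are split by the partial fractions
  \<open>1 / ((a + 1) (b + 1)) = (1 - 1 / (a + 1) - 1 / (b + 1)) / (a b - 1)\<close> and
  \<open>1 / ((a - 1) (b + 1)) = (1 + 1 / (a - 1) - 1 / (b + 1)) / (a b + 1)\<close>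
  (lemmas \<open>egf_euler_euler\<close> and \<open>egf_bernoulli_euler\<close>). On the right, one term has its whole
  dependence on \<open>t\<close> in the argument \<open>y + (x - y) t\<close> of a single polynomial, and it integrates to a
  difference quotient by \<open>B\<^sub>n' = n B\<^sub>n\<^sub>-\<^sub>1\<close> and \<open>E\<^sub>n' = n E\<^sub>n\<^sub>-\<^sub>1\<close>. The other two depend on \<open>t\<close> only through
  powers of \<open>t\<close> and \<open>1 - t\<close>.

  Comparing coefficients and integrating over \<open>[0, 1]\<close> gives the first and the third identity.
  For the second one, the coefficient identity is divided by \<open>t\<close> before integrating. The terms
  with index \<open>0\<close> then combine to
  \<open>- E\<^sub>n(y) (1 - (1 - t)\<^sup>n) / t = - E\<^sub>n(y) (\<Sum>j<n. (1 - t)\<^sup>j)\<close>, which is where the harmonic number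
  comes from.
\<close>

section \<open>Exponential generating functions\<close>

text \<open>
  The exponential generating function of a sequence. Its product is the binomial convolution.
\<close>

definition egf :: "(nat \<Rightarrow> 'a :: field_char_0) \<Rightarrow> 'a fps" where
  "egf f = Abs_fps (\<lambda>n. f n / fact n)"

lemma egf_eq_iff: "egf f = egf g \<longleftrightarrow> f = g"
  by (auto simp: egf_def fps_eq_iff)

lemma egf_add: "egf f + egf g = egf (\<lambda>n. f n + g n)"
  by (simp add: egf_def fps_eq_iff add_divide_distrib)

lemma egf_diff: "egf f - egf g = egf (\<lambda>n. f n - g n)"
  by (simp add: egf_def fps_eq_iff diff_divide_distrib)

lemma egf_const_mult: "fps_const c * egf f = egf (\<lambda>n. c * f n)"
  by (simp add: egf_def fps_eq_iff)

lemma egf_mult: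
  "egf f * egf g = egf (\<lambda>n. \<Sum>k=0..n. of_nat (n choose k) * (f k * g (n - k)))"
  by (auto simp: egf_def fps_eq_iff fps_mult_nth sum_divide_distrib binomial_fact
           intro!: sum.cong)

lemma fps_X_mult_egf: "fps_X * egf f = egf (\<lambda>n. of_nat n * f (n - 1))"
proof -
  have "fps_nth (fps_X * egf f) n = fps_nth (egf (\<lambda>n. of_nat n * f (n - 1))) n" for n
    by (cases n) (simp_all add: egf_def del: of_nat_Suc)
  then show ?thesis
    by (simp add: fps_eq_iff)
qed

lemma egf_power: "egf (\<lambda>n. x ^ n) = fps_exp x"
  by (simp add: egf_def fps_eq_iff)

lemma egf_compose_linear:
  "egf f oo (fps_const t * fps_X) = egf (\<lambda>n. t ^ n * f n)"
  by (simp add: egf_def fps_compose_linear)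

lemma egf_euler:
  "egf (\<lambda>n. euler_polynomial n x) * (fps_exp 1 + 1) = 2 * fps_exp x"
proof -
  have "egf (\<lambda>n. euler_polynomial n x) = 2 * fps_exp x / (fps_exp 1 + 1)"
    by (rule fps_ext) (simp only: egf_def euler_polynomial_def fps_nth_Abs_fps
        nonzero_mult_div_cancel_left[OF fact_nonzero])
  moreover have "(fps_exp 1 + 1 :: complex fps) dvd 2 * fps_exp x"
    by (rule unit_imp_dvd) (simp add: fps_is_unit_iff)
  ultimately show ?thesis
    by simp
qed

lemma egf_bernoulli:
  "egf (\<lambda>n. bernoulli_polynomial n x) * (fps_exp 1 - 1) = fps_X * fps_exp x"
proof -
  have "egf bernoulli_number = fps_X / (fps_exp 1 - 1)"
    by (rule fps_ext) (simp only: egf_def bernoulli_number_def fps_nth_Abs_fps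
        nonzero_mult_div_cancel_left[OF fact_nonzero])
  moreover have "(fps_exp 1 - 1 :: complex fps) dvd fps_X"
  proof -
    have "subdegree (fps_exp 1 - 1 :: complex fps) = 1"
      by (rule subdegreeI) auto
    moreover have "fps_exp 1 - 1 \<noteq> (0 :: complex fps)"
      using calculation by auto
    ultimately show ?thesis
      by (simp add: fps_dvd_iff)
  qed
  ultimately have "egf bernoulli_number * (fps_exp 1 - 1) = fps_X"
    by simp
  moreover have "egf (\<lambda>n. bernoulli_polynomial n x) = egf bernoulli_number * fps_exp x"
    by (simp add: egf_mult bernoulli_polynomial_def mult.assoc flip: egf_power)
  ultimately show ?thesis
    by (simp add: mult.commute mult.left_commute)
qed

text \<open>Substituting \<open>t z\<close> for \<open>z\<close> in the two generating functions.\<close>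

lemma egf_euler_scaled:
  "egf (\<lambda>n. t ^ n * euler_polynomial n x) * (fps_exp t + 1) = 2 * fps_exp (t * x)"
proof -
  have "(egf (\<lambda>n. euler_polynomial n x) * (fps_exp 1 + 1)) oo (fps_const t * fps_X)
          = (fps_const 2 * fps_exp x) oo (fps_const t * fps_X)"
    by (simp only: egf_euler numeral_fps_const)
  then show ?thesis
    by (simp add: fps_compose_mult_distrib fps_compose_add_distrib egf_compose_linear
                  fps_exp_compose_linear numeral_fps_const)
qed

lemma egf_bernoulli_scaled:
  "egf (\<lambda>n. t ^ n * bernoulli_polynomial n x) * (fps_exp t - 1)
     = fps_const t * fps_X * fps_exp (t * x)"
proof -
  have "(egf (\<lambda>n. bernoulli_polynomial n x) * (fps_exp 1 - 1)) oo (fps_const t * fps_X)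
          = (fps_X * fps_exp x) oo (fps_const t * fps_X)"
    by (simp only: egf_bernoulli)
  then show ?thesis
    by (simp add: fps_compose_mult_distrib fps_compose_sub_distrib egf_compose_linear
                  fps_exp_compose_linear)
qed

lemma fps_exp_plus_1_neq_0: "fps_exp c + 1 \<noteq> (0 :: complex fps)"
proof
  assume "fps_exp c + 1 = (0 :: complex fps)"
  then have "fps_nth (fps_exp c + 1) 0 = fps_nth (0 :: complex fps) 0"
    by (rule arg_cong)
  then show False
    by simp
qed

lemma fps_exp_minus_1_neq_0: "c \<noteq> 0 \<Longrightarrow> fps_exp c - 1 \<noteq> (0 :: complex fps)"
  by simp

section \<open>Binomial convolutions with a parameter\<close>

text \<open>
  The partial fraction decomposition of \<open>1 / ((a + 1) (b + 1))\<close>. The factor \<open>z\<close> on the left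
  compensates the simple pole of \<open>1 / (e\<^sup>z - 1)\<close>.
\<close>

lemma egf_euler_euler:
  fixes t x y :: complex
  shows "fps_X * (egf (\<lambda>n. t ^ n * euler_polynomial n x)
                    * egf (\<lambda>n. (1 - t) ^ n * euler_polynomial n y))
    = fps_const 4 * egf (\<lambda>n. bernoulli_polynomial n (y + (x - y) * t))
      - fps_const 2 * (egf (\<lambda>n. t ^ n * euler_polynomial n (x - y))
                         * egf (\<lambda>n. bernoulli_polynomial n y)
                     + egf (\<lambda>n. (1 - t) ^ n * euler_polynomial n (y - x))
                         * egf (\<lambda>n. bernoulli_polynomial n x))"
    (is "fps_X * (?E1 * ?E2) = _ * ?B - _ * (?E3 * ?B1 + ?E4 * ?B2)")
proof -
  define a b c where "a = fps_exp t" and "b = fps_exp (1 - t)"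
    and "c = fps_exp (y + (x - y) * t)"
  define d1 d2 where "d1 = fps_exp (t * (x - y))" and "d2 = fps_exp ((1 - t) * (y - x))"
  have ab: "a * b = fps_exp 1"
    by (simp add: a_def b_def flip: fps_exp_add_mult)
  have c1: "fps_exp (t * x) * fps_exp ((1 - t) * y) = c"
    by (simp add: c_def algebra_simps flip: fps_exp_add_mult)
  have c2: "d1 * fps_exp y = c"
    by (simp add: c_def d1_def algebra_simps flip: fps_exp_add_mult)
  have c3: "d2 * fps_exp x = c"
    by (simp add: c_def d2_def algebra_simps flip: fps_exp_add_mult)
  have E1: "?E1 * (a + 1) = 2 * fps_exp (t * x)"
    unfolding a_def by (rule egf_euler_scaled)
  have E2: "?E2 * (b + 1) = 2 * fps_exp ((1 - t) * y)"
    unfolding b_def by (rule egf_euler_scaled)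
  have E3: "?E3 * (a + 1) = 2 * d1"
    unfolding a_def d1_def by (rule egf_euler_scaled)
  have E4: "?E4 * (b + 1) = 2 * d2"
    unfolding b_def d2_def by (rule egf_euler_scaled)
  have B: "?B * (a * b - 1) = fps_X * c"
    unfolding ab c_def by (rule egf_bernoulli)
  have B1: "?B1 * (a * b - 1) = fps_X * fps_exp y" and B2: "?B2 * (a * b - 1) = fps_X * fps_exp x"
    unfolding ab by (rule egf_bernoulli)+
  \<comment> \<open>Both sides agree after multiplication by the non-zero product of the three denominators.\<close>
  have "(fps_X * (?E1 * ?E2)) * ((a + 1) * (b + 1) * (a * b - 1))
      = fps_X * ((?E1 * (a + 1)) * (?E2 * (b + 1))) * (a * b - 1)"
    by (simp only: mult_ac)
  also have "\<dots> = 4 * fps_X * c * (a * b - 1)"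
    unfolding E1 E2 c1[symmetric] by (simp add: mult_ac)
  also have "\<dots> = 4 * (fps_X * c) * ((a + 1) * (b + 1))
      - 2 * ((2 * fps_X * c) * (b + 1) + (2 * fps_X * c) * (a + 1))"
    by (simp add: algebra_simps)
  also have "\<dots> = 4 * (?B * (a * b - 1)) * ((a + 1) * (b + 1))
      - 2 * ((?E3 * (a + 1)) * (?B1 * (a * b - 1)) * (b + 1)
           + (?E4 * (b + 1)) * (?B2 * (a * b - 1)) * (a + 1))"
  proof -
    have "(2 * d1) * (fps_X * fps_exp y) = 2 * fps_X * c"
      unfolding c2[symmetric] by (simp only: mult_ac)
    moreover have "(2 * d2) * (fps_X * fps_exp x) = 2 * fps_X * c"
      unfolding c3[symmetric] by (simp only: mult_ac)
    ultimately show ?thesis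
      unfolding B E3 E4 B1 B2 by (simp only: mult_ac)
  qed
  also have "\<dots> = (4 * ?B - 2 * (?E3 * ?B1 + ?E4 * ?B2)) * ((a + 1) * (b + 1) * (a * b - 1))"
  proof -
    have "4 * (u * r) * (p * q) - 2 * ((v * p) * (w * r) * q + (v' * q) * (w' * r) * p)
        = (4 * u - 2 * (v * w + v' * w')) * (p * q * r)" for u v w v' w' p q r :: "complex fps"
      by (simp add: algebra_simps)
    then show ?thesis .
  qed
  finally have "fps_X * (?E1 * ?E2) = 4 * ?B - 2 * (?E3 * ?B1 + ?E4 * ?B2)"
    using fps_exp_plus_1_neq_0[of t] fps_exp_plus_1_neq_0[of "1 - t"]
      fps_exp_minus_1_neq_0[of 1, folded ab]
    by (simp add: a_def[symmetric] b_def[symmetric] del: fps_exp_eq_iff)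
  then show ?thesis
    by (simp add: numeral_fps_const)
qed

text \<open>
  The partial fraction decomposition of \<open>1 / ((a - 1) (b + 1))\<close>, where \<open>t \<noteq> 0\<close> ensures that
  \<open>a \<noteq> 1\<close>.
\<close>

lemma egf_bernoulli_euler:
  fixes t x y :: complex
  assumes "t \<noteq> 0"
  shows "egf (\<lambda>n. t ^ n * bernoulli_polynomial n x)
           * egf (\<lambda>n. (1 - t) ^ n * euler_polynomial n y)
    = fps_const t * (fps_X * egf (\<lambda>n. euler_polynomial n (y + (x - y) * t)))
      + egf (\<lambda>n. t ^ n * bernoulli_polynomial n (x - y)) * egf (\<lambda>n. euler_polynomial n y)
      - fps_const (t / 2) * (fps_X * (egf (\<lambda>n. (1 - t) ^ n * euler_polynomial n (y - x))
                                         * egf (\<lambda>n. euler_polynomial n x)))"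
    (is "?B1 * ?E1 = _ * (_ * ?E) + ?B2 * ?E2 - _ * (_ * (?E3 * ?E4))")
proof -
  define a b c where "a = fps_exp t" and "b = fps_exp (1 - t)"
    and "c = fps_exp (y + (x - y) * t)"
  define d1 d2 where "d1 = fps_exp (t * (x - y))" and "d2 = fps_exp ((1 - t) * (y - x))"
  define T where "T = fps_const t * fps_X"
  have ab: "a * b = fps_exp 1"
    by (simp add: a_def b_def flip: fps_exp_add_mult)
  have c1: "fps_exp (t * x) * fps_exp ((1 - t) * y) = c"
    by (simp add: c_def algebra_simps flip: fps_exp_add_mult)
  have c2: "d1 * fps_exp y = c"
    by (simp add: c_def d1_def algebra_simps flip: fps_exp_add_mult)
  have c3: "d2 * fps_exp x = c"
    by (simp add: c_def d2_def algebra_simps flip: fps_exp_add_mult)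
  have B1: "?B1 * (a - 1) = T * fps_exp (t * x)"
    unfolding a_def T_def by (rule egf_bernoulli_scaled)
  have E1: "?E1 * (b + 1) = 2 * fps_exp ((1 - t) * y)"
    unfolding b_def by (rule egf_euler_scaled)
  have B2: "?B2 * (a - 1) = T * d1"
    unfolding a_def d1_def T_def by (rule egf_bernoulli_scaled)
  have E3: "?E3 * (b + 1) = 2 * d2"
    unfolding b_def d2_def by (rule egf_euler_scaled)
  have E: "?E * (a * b + 1) = 2 * c"
    unfolding ab c_def by (rule egf_euler)
  have E2: "?E2 * (a * b + 1) = 2 * fps_exp y" and E4: "?E4 * (a * b + 1) = 2 * fps_exp x"
    unfolding ab by (rule egf_euler)+
  \<comment> \<open>The identity is doubled to keep fractions out of the ring computation.\<close>
  have "(2 * (?B1 * ?E1)) * ((a - 1) * (b + 1) * (a * b + 1))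
      = 2 * ((?B1 * (a - 1)) * (?E1 * (b + 1))) * (a * b + 1)"
    by (simp only: mult_ac)
  also have "\<dots> = 4 * T * c * (a * b + 1)"
    unfolding E1 B1 c1[symmetric] by (simp add: mult_ac)
  also have "\<dots> = 2 * T * (2 * c) * ((a - 1) * (b + 1))
      + 2 * (2 * T * c) * (b + 1) - T * (4 * c) * (a - 1)"
    by (simp add: algebra_simps)
  also have "\<dots> = 2 * T * (?E * (a * b + 1)) * ((a - 1) * (b + 1))
      + 2 * ((?B2 * (a - 1)) * (?E2 * (a * b + 1))) * (b + 1)
      - T * ((?E3 * (b + 1)) * (?E4 * (a * b + 1))) * (a - 1)"
  proof -
    have "(T * d1) * (2 * fps_exp y) = 2 * T * c"
      unfolding c2[symmetric] by (simp only: mult_ac)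
    moreover have "(2 * d2) * (2 * fps_exp x) = 4 * c"
      unfolding c3[symmetric] by (simp add: mult_ac)
    ultimately show ?thesis
      unfolding E B2 E2 E3 E4 by (simp only: mult_ac)
  qed
  also have "\<dots> = (2 * T * ?E + 2 * (?B2 * ?E2) - T * (?E3 * ?E4))
                    * ((a - 1) * (b + 1) * (a * b + 1))"
  proof -
    have "2 * T * (u * r) * (p * q) + 2 * ((v * p) * (w * r)) * q - T * ((v' * q) * (w' * r)) * p
        = (2 * T * u + 2 * (v * w) - T * (v' * w')) * (p * q * r)"
      for u v w v' w' p q r :: "complex fps"
      by (simp add: algebra_simps)
    then show ?thesis .
  qed
  finally have "2 * (?B1 * ?E1) = 2 * T * ?E + 2 * (?B2 * ?E2) - T * (?E3 * ?E4)"
    using fps_exp_minus_1_neq_0[OF assms] fps_exp_plus_1_neq_0[of "1 - t"]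
      fps_exp_plus_1_neq_0[of 1, folded ab]
    by (simp add: a_def[symmetric] b_def[symmetric] del: fps_exp_eq_iff)
  then have "fps_const (1/2) * (2 * (?B1 * ?E1))
      = fps_const (1/2) * (2 * T * ?E + 2 * (?B2 * ?E2) - T * (?E3 * ?E4))"
    by (rule arg_cong)
  moreover have half: "fps_const (1/2) * (2 * A) = A" for A :: "complex fps"
    by (simp add: numeral_fps_const flip: mult.assoc)
  moreover have "fps_const (1/2) * (T * A) = fps_const (t / 2) * (fps_X * A)" for A
    by (simp add: T_def flip: mult.assoc)
  ultimately show ?thesis
    by (simp add: T_def ring_distribs mult.assoc)
qed

lemma euler_euler_convolution:
  fixes t x y :: complex
  shows "of_nat (n + 1) * (\<Sum>k=0..n. of_nat (n choose k) *
            (t ^ k * euler_polynomial k x * ((1 - t) ^ (n - k) * euler_polynomial (n - k) y)))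
    = 4 * bernoulli_polynomial (n + 1) (y + (x - y) * t)
      - 2 * (\<Sum>l=0..n+1. of_nat ((n + 1) choose l) *
            (t ^ l * euler_polynomial l (x - y) * bernoulli_polynomial (n + 1 - l) y
             + (1 - t) ^ l * euler_polynomial l (y - x) * bernoulli_polynomial (n + 1 - l) x))"
proof -
  note egf_euler_euler[of t x y,
      unfolded egf_mult fps_X_mult_egf egf_const_mult egf_diff egf_add egf_eq_iff]
  from fun_cong[OF this, of "n + 1"] show ?thesis
    by (simp add: ring_distribs sum.distrib)
qed

lemma bernoulli_euler_convolution:
  fixes t x y :: complex
  assumes "t \<noteq> 0"
  shows "(\<Sum>k=0..n+1. of_nat ((n + 1) choose k) * (t ^ k * bernoulli_polynomial k x *
            ((1 - t) ^ (n + 1 - k) * euler_polynomial (n + 1 - k) y)))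
    = t * (of_nat (n + 1) * euler_polynomial n (y + (x - y) * t))
      + (\<Sum>l=0..n+1. of_nat ((n + 1) choose l) *
            (t ^ l * bernoulli_polynomial l (x - y) * euler_polynomial (n + 1 - l) y))
      - t / 2 * (of_nat (n + 1) * (\<Sum>l=0..n. of_nat (n choose l) *
            ((1 - t) ^ l * euler_polynomial l (y - x) * euler_polynomial (n - l) x)))"
proof -
  note egf_bernoulli_euler[OF assms, of x y,
      unfolded egf_mult fps_X_mult_egf egf_const_mult egf_diff egf_add egf_eq_iff]
  from fun_cong[OF this, of "n + 1"] show ?thesis
    by (simp only: add_diff_cancel_right')
qed

section \<open>Derivatives\<close>

text \<open>
  Polynomials of the form \<open>P\<^sub>n(x) = \<Sum>k. (n choose k) c\<^sub>k x\<^sup>n\<^sup>-\<^sup>k\<close> form an Appell sequence: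
  \<open>P\<^sub>n' = n P\<^sub>n\<^sub>-\<^sub>1\<close>. Both the Bernoulli and the Euler polynomials are of this form.
\<close>

lemma appell_sum_has_field_derivative:
  fixes c :: "nat \<Rightarrow> complex"
  shows "((\<lambda>x. \<Sum>k=0..n+1. of_nat ((n + 1) choose k) * c k * x ^ (n + 1 - k)) has_field_derivative
     of_nat (n + 1) * (\<Sum>k=0..n. of_nat (n choose k) * c k * x ^ (n - k))) (at x)"
proof -
  have "((\<lambda>x. \<Sum>k=0..n+1. of_nat ((n + 1) choose k) * c k * x ^ (n + 1 - k)) has_field_derivative
     (\<Sum>k=0..n+1. of_nat ((n + 1) choose k) * c k * (of_nat (n + 1 - k) * x ^ (n - k)))) (at x)"
    by (auto intro!: derivative_eq_intros sum.cong)
  also have "(\<Sum>k=0..n+1. of_nat ((n + 1) choose k) * c k * (of_nat (n + 1 - k) * x ^ (n - k)))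
     = of_nat (n + 1) * (\<Sum>k=0..n. of_nat (n choose k) * c k * x ^ (n - k))"
  proof -
    have "of_nat ((n + 1) choose k) * c k * (of_nat (n + 1 - k) * x ^ (n - k))
        = of_nat (n + 1) * (of_nat (n choose k) * c k * x ^ (n - k))" if "k \<le> n" for k
    proof -
      have "(n + 1 - k) * ((n + 1) choose k) = (n + 1) * (n choose k)"
        using binomial_absorb_comp[of "n + 1" k] by simp
      then have "of_nat (n + 1 - k) * of_nat ((n + 1) choose k)
          = (of_nat (n + 1) * of_nat (n choose k) :: complex)"
        by (metis of_nat_mult)
      then have "(of_nat (n + 1 - k) * of_nat ((n + 1) choose k)) * (c k * x ^ (n - k))
          = (of_nat (n + 1) * of_nat (n choose k)) * (c k * x ^ (n - k))"
        by (rule arg_cong)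
      then show ?thesis
        by (simp only: mult_ac)
    qed
    then have "(\<Sum>k=0..n. of_nat ((n + 1) choose k) * c k * (of_nat (n + 1 - k) * x ^ (n - k)))
        = (\<Sum>k=0..n. of_nat (n + 1) * (of_nat (n choose k) * c k * x ^ (n - k)))"
      by (intro sum.cong refl) (metis atLeastAtMost_iff)
    moreover have "(\<Sum>k=0..n+1. f k * (of_nat (n + 1 - k) * g k))
        = (\<Sum>k=0..n. f k * (of_nat (n + 1 - k) * g k))" for f g :: "nat \<Rightarrow> complex"
      by simp
    ultimately show ?thesis
      by (simp only: sum_distrib_left)
  qed
  finally show ?thesis .
qed

lemma bernoulli_polynomial_has_field_derivative:
  "(bernoulli_polynomial (n + 1) has_field_derivative
     of_nat (n + 1) * bernoulli_polynomial n x) (at x)"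
  unfolding bernoulli_polynomial_def[abs_def]
  by (rule appell_sum_has_field_derivative)

lemma euler_polynomial_conv_sum:
  "euler_polynomial n x
     = (\<Sum>k=0..n. of_nat (n choose k) * euler_polynomial k 0 * x ^ (n - k))"
proof -
  have "egf (\<lambda>n. euler_polynomial n x) * (fps_exp 1 + 1)
      = egf (\<lambda>n. euler_polynomial n 0) * fps_exp x * (fps_exp 1 + 1)"
    using egf_euler[of x] egf_euler[of 0] by (simp add: mult_ac)
  then have "egf (\<lambda>n. euler_polynomial n x) = egf (\<lambda>n. euler_polynomial n 0) * fps_exp x"
    using fps_exp_plus_1_neq_0[of 1] by simp
  then have "(\<lambda>n. euler_polynomial n x)
      = (\<lambda>n. \<Sum>k=0..n. of_nat (n choose k) * (euler_polynomial k 0 * x ^ (n - k)))"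
    unfolding egf_power[symmetric] egf_mult egf_eq_iff .
  from fun_cong[OF this, of n] show ?thesis
    by (simp only: mult.assoc)
qed

lemma euler_polynomial_has_field_derivative:
  "(euler_polynomial (n + 1) has_field_derivative of_nat (n + 1) * euler_polynomial n x) (at x)"
  using appell_sum_has_field_derivative[of n "\<lambda>k. euler_polynomial k 0" x]
  by (simp only: euler_polynomial_conv_sum[symmetric])

section \<open>Integrals\<close>

lemma fundamental_theorem_of_calculus_complex_unit:
  fixes F f :: "complex \<Rightarrow> complex"
  assumes "\<And>z. (F has_field_derivative f z) (at z)"
  shows "((\<lambda>t. f (of_real t)) has_integral F 1 - F 0) {0..1}"
  using fundamental_theorem_of_calculus[of 0 1 "\<lambda>t. F (of_real t)" "\<lambda>t. f (of_real t)"]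
    has_vector_derivative_real_field[OF assms]
  by simp

text \<open>The Beta integral at positive integer arguments.\<close>

lemma has_integral_power_mult_power_unit:
  "((\<lambda>t. of_real t ^ a * (1 - of_real t) ^ b) has_integral
     (fact a * fact b / fact (a + b + 1) :: complex)) {0..1}"
proof (induction b arbitrary: a)
  case 0
  have "((\<lambda>z. z ^ Suc a / of_nat (Suc a)) has_field_derivative z ^ a) (at z)" for z :: complex
    using DERIV_cdivide[OF DERIV_power[OF DERIV_ident[of "at z"], of "Suc a"], of "of_nat (Suc a)"]
    by (simp del: of_nat_Suc power_Suc)
  note integral = fundamental_theorem_of_calculus_complex_unit[OF this]
  have val: "fact a * fact 0 / fact (a + 0 + 1) = (1 / of_nat (Suc a) :: complex)"
    by (simp add: divide_simps del: of_nat_Suc)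
  show ?case
    unfolding val using integral by (simp del: of_nat_Suc)
next
  case (Suc b)
  \<comment> \<open>\<open>t\<^sup>a (1 - t)\<^sup>b\<^sup>+\<^sup>1 = t\<^sup>a (1 - t)\<^sup>b - t\<^sup>a\<^sup>+\<^sup>1 (1 - t)\<^sup>b\<close>\<close>
  have "((\<lambda>t. of_real t ^ a * (1 - of_real t) ^ b - of_real t ^ Suc a * (1 - of_real t) ^ b)
      has_integral (fact a * fact b / fact (a + b + 1)
                    - fact (Suc a) * fact b / fact (Suc a + b + 1) :: complex)) {0..1}"
    by (intro has_integral_diff Suc.IH)
  moreover have "fact a * fact b / fact (a + b + 1) - fact (Suc a) * fact b / fact (Suc a + b + 1)
      = (fact a * fact (Suc b) / fact (a + Suc b + 1) :: complex)"
  proof -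
    have "fact (a + b + 2) = (of_nat (a + b + 2) * fact (a + b + 1) :: complex)"
      by (simp add: fact_reduce)
    moreover have "of_nat (a + b + 2) \<noteq> (0 :: complex)"
      unfolding of_nat_eq_0_iff by simp
    ultimately show ?thesis
      by (simp add: divide_simps del: of_nat_add) (simp add: algebra_simps)
  qed
  ultimately show ?case
    by (simp add: algebra_simps)
qed

lemma has_integral_power_unit:
  "((\<lambda>t. of_real t ^ a) has_integral (1 / of_nat (a + 1) :: complex)) {0..1}"
  using has_integral_power_mult_power_unit[of a 0] by (simp add: divide_simps flip: distrib_left)

lemma has_integral_one_minus_power_unit:
  "((\<lambda>t. (1 - of_real t) ^ b) has_integral (1 / of_nat (b + 1) :: complex)) {0..1}"
  using has_integral_power_mult_power_unit[of 0 b] by (simp add: divide_simps flip: distrib_left)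

lemma has_integral_one_minus_power_weighted_unit:
  "((\<lambda>t. of_real t * (1 - of_real t) ^ b) has_integral
     (1 / (of_nat (b + 1) * of_nat (b + 2)) :: complex)) {0..1}"
proof -
  have "((\<lambda>t. (1 - of_real t) ^ b - (1 - of_real t) ^ (b + 1)) has_integral
     (1 / of_nat (b + 1) - 1 / of_nat (b + 1 + 1) :: complex)) {0..1}"
    by (intro has_integral_diff has_integral_one_minus_power_unit)
  moreover have "1 / of_nat (b + 1) - 1 / of_nat (b + 1 + 1)
      = (1 / (of_nat (b + 1) * of_nat (b + 2)) :: complex)"
  proof -
    have "of_nat (b + 1) \<noteq> (0 :: complex)" "of_nat (b + 2) \<noteq> (0 :: complex)"
      unfolding of_nat_eq_0_iff by simp_all
    then show ?thesis
      by (simp add: divide_simps del: of_nat_add)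
  qed
  ultimately show ?thesis
    by (simp add: algebra_simps)
qed

lemma binomial_mult_beta:
  assumes "k \<le> n"
  shows "of_nat (n choose k) * (fact k * fact (n - k) / fact (n + 1)) = (1 / of_nat (n + 1) :: complex)"
proof -
  have "fact k * fact (n - k) * of_nat (n choose k) = (fact n :: complex)"
    using binomial_fact_lemma[OF assms] by (metis of_nat_fact of_nat_mult)
  then have "of_nat (n choose k) * (fact k * fact (n - k) / fact (n + 1))
      = (fact n / fact (n + 1) :: complex)"
    by (simp add: mult_ac)
  also have "\<dots> = 1 / of_nat (n + 1)"
    by (simp add: divide_simps del: of_nat_Suc)
  finally show ?thesis .
qed

text \<open>
  Integration over the parameter removes the binomial coefficients from a binomial convolution.
\<close>

lemma has_integral_binomial_convolution:
  fixes f g :: "nat \<Rightarrow> complex"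
  shows "((\<lambda>t. of_nat (n + 1) * (\<Sum>k=0..n. of_nat (n choose k) *
            (of_real t ^ k * f k * ((1 - of_real t) ^ (n - k) * g (n - k)))))
          has_integral (\<Sum>k=0..n. f k * g (n - k))) {0..1}"
proof -
  have "((\<lambda>t. \<Sum>k=0..n. (of_nat (n choose k) * (f k * g (n - k))) *
            (of_real t ^ k * (1 - of_real t) ^ (n - k)))
          has_integral (\<Sum>k=0..n. (of_nat (n choose k) * (f k * g (n - k))) *
            (fact k * fact (n - k) / fact (k + (n - k) + 1)))) {0..1}"
    by (intro has_integral_sum has_integral_mult_right has_integral_power_mult_power_unit) auto
  from has_integral_mult_right[OF this, of "of_nat (n + 1)"]
  have "((\<lambda>t. of_nat (n + 1) * (\<Sum>k=0..n. (of_nat (n choose k) * (f k * g (n - k))) *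
            (of_real t ^ k * (1 - of_real t) ^ (n - k))))
          has_integral of_nat (n + 1) * (\<Sum>k=0..n. (of_nat (n choose k) * (f k * g (n - k))) *
            (fact k * fact (n - k) / fact (k + (n - k) + 1)))) {0..1}" .
  moreover have "of_nat (n + 1) * (\<Sum>k=0..n. (of_nat (n choose k) * (f k * g (n - k))) *
            (fact k * fact (n - k) / fact (k + (n - k) + 1))) = (\<Sum>k=0..n. f k * g (n - k))"
    unfolding sum_distrib_left
  proof (rule sum.cong)
    fix k assume "k \<in> {0..n}"
    then have "k \<le> n" by simp
    have "of_nat (n + 1) * (of_nat (n choose k) * (f k * g (n - k)) *
            (fact k * fact (n - k) / fact (k + (n - k) + 1)))
        = of_nat (n + 1) * (of_nat (n choose k) * (fact k * fact (n - k) / fact (n + 1)))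
            * (f k * g (n - k))"
      using \<open>k \<le> n\<close> by (simp only: le_add_diff_inverse mult_ac)
    also have "\<dots> = f k * g (n - k)"
      unfolding binomial_mult_beta[OF \<open>k \<le> n\<close>] by (simp del: of_nat_Suc)
    finally show "of_nat (n + 1) * (of_nat (n choose k) * (f k * g (n - k)) *
            (fact k * fact (n - k) / fact (k + (n - k) + 1))) = f k * g (n - k)" .
  qed simp
  ultimately show ?thesis
    by (simp add: mult_ac del: of_nat_Suc)
qed

lemma has_integral_bernoulli_segment:
  assumes "x \<noteq> y"
  shows "((\<lambda>t. bernoulli_polynomial n (y + (x - y) * of_real t)) has_integral
           (bernoulli_polynomial (n + 1) x - bernoulli_polynomial (n + 1) y)
             / (of_nat (n + 1) * (x - y))) {0..1}"
proof -
  have "((\<lambda>z. bernoulli_polynomial (n + 1) (y + (x - y) * z) / (of_nat (n + 1) * (x - y)))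
      has_field_derivative bernoulli_polynomial n (y + (x - y) * z)) (at z)" for z
  proof -
    have "((\<lambda>z. y + (x - y) * z) has_field_derivative (x - y)) (at z)"
      by (auto intro!: derivative_eq_intros)
    from DERIV_cdivide[OF DERIV_chain2[OF bernoulli_polynomial_has_field_derivative this],
        of n "(of_nat (n + 1) * (x - y))"]
    show ?thesis
      using assms by (simp del: of_nat_Suc)
  qed
  from fundamental_theorem_of_calculus_complex_unit[OF this] show ?thesis
    by (simp add: diff_divide_distrib)
qed

lemma has_integral_euler_segment:
  assumes "x \<noteq> y"
  shows "((\<lambda>t. of_nat (n + 1) * euler_polynomial n (y + (x - y) * of_real t)) has_integral
           (euler_polynomial (n + 1) x - euler_polynomial (n + 1) y) / (x - y)) {0..1}"
proof -
  have "((\<lambda>z. euler_polynomial (n + 1) (y + (x - y) * z) / (x - y))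
      has_field_derivative of_nat (n + 1) * euler_polynomial n (y + (x - y) * z)) (at z)" for z
  proof -
    have "((\<lambda>z. y + (x - y) * z) has_field_derivative (x - y)) (at z)"
      by (auto intro!: derivative_eq_intros)
    from DERIV_cdivide[OF DERIV_chain2[OF euler_polynomial_has_field_derivative this],
        of n "(x - y)"]
    show ?thesis
      using assms by (simp del: of_nat_Suc)
  qed
  from fundamental_theorem_of_calculus_complex_unit[OF this] show ?thesis
    by (simp add: diff_divide_distrib)
qed

lemma has_integral_euler_segment_weighted:
  assumes "x \<noteq> y"
  shows "((\<lambda>t. of_real t * (of_nat (n + 1) * euler_polynomial n (y + (x - y) * of_real t)))
      has_integral euler_polynomial (n + 1) x / (x - y)
        - (euler_polynomial (n + 2) x - euler_polynomial (n + 2) y)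
            / (of_nat (n + 2) * (x - y) ^ 2)) {0..1}"
proof -
  define u where "u z = y + (x - y) * z" for z
  have du: "(u has_field_derivative (x - y)) (at z)" for z
    unfolding u_def by (auto intro!: derivative_eq_intros)
  have d1: "((\<lambda>z. euler_polynomial (n + 1) (u z)) has_field_derivative
              of_nat (n + 1) * euler_polynomial n (u z) * (x - y)) (at z)" for z
    by (rule DERIV_chain2[OF euler_polynomial_has_field_derivative du])
  have d2: "((\<lambda>z. euler_polynomial (n + 2) (u z)) has_field_derivative
              of_nat (n + 2) * euler_polynomial (n + 1) (u z) * (x - y)) (at z)" for z
    using DERIV_chain2[OF euler_polynomial_has_field_derivative[of "n + 1"] du] by simp
  have nz: "of_nat (n + 2) \<noteq> (0 :: complex)"
    unfolding of_nat_eq_0_iff by simp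
  \<comment> \<open>This antiderivative comes from integration by parts.\<close>
  have "((\<lambda>z. z * euler_polynomial (n + 1) (u z) / (x - y)
              - euler_polynomial (n + 2) (u z) / (of_nat (n + 2) * (x - y) ^ 2))
      has_field_derivative
        (1 * euler_polynomial (n + 1) (u z)
          + of_nat (n + 1) * euler_polynomial n (u z) * (x - y) * z) / (x - y)
        - of_nat (n + 2) * euler_polynomial (n + 1) (u z) * (x - y)
            / (of_nat (n + 2) * (x - y) ^ 2)) (at z)" for z
    by (intro DERIV_diff DERIV_cdivide DERIV_mult' DERIV_mult DERIV_ident d1 d2)
  moreover have "(1 * euler_polynomial (n + 1) (u z)
          + of_nat (n + 1) * euler_polynomial n (u z) * (x - y) * z) / (x - y)
        - of_nat (n + 2) * euler_polynomial (n + 1) (u z) * (x - y)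
            / (of_nat (n + 2) * (x - y) ^ 2)
      = z * (of_nat (n + 1) * euler_polynomial n (u z))" for z
    using assms nz by (simp add: divide_simps power2_eq_square del: of_nat_add)
  ultimately have *: "((\<lambda>z. z * euler_polynomial (n + 1) (u z) / (x - y)
              - euler_polynomial (n + 2) (u z) / (of_nat (n + 2) * (x - y) ^ 2))
      has_field_derivative z * (of_nat (n + 1) * euler_polynomial n (u z))) (at z)" for z
    by simp
  have "u 1 = x" "u 0 = y"
    by (simp_all add: u_def)
  with fundamental_theorem_of_calculus_complex_unit[OF *] show ?thesis
    unfolding u_def[symmetric]
    by (simp add: diff_divide_distrib diff_diff_eq2 diff_add_eq del: of_nat_add of_nat_Suc)
qed

section \<open>The three identities\<close>

lemma sum_split_first:
  fixes f :: "nat \<Rightarrow> 'a :: comm_monoid_add"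
  shows "(\<Sum>k=0..n+1. f k) = f 0 + (\<Sum>l=0..n. f (l + 1))"
  by (simp add: sum.atLeast0_atMost_Suc_shift del: sum.cl_ivl_Suc)

lemma sum_from_1:
  fixes f :: "nat \<Rightarrow> 'a :: comm_monoid_add"
  shows "(\<Sum>k=1..n+1. f k) = (\<Sum>l=0..n. f (l + 1))"
  using sum.shift_bounds_cl_Suc_ivl[of f 0 n] by (simp del: sum.cl_ivl_Suc)

lemma sum_euler_euler:
  assumes "x \<noteq> y"
  shows "(\<Sum>k=0..n. euler_polynomial k x * euler_polynomial (n - k) y)
      - 4 / of_nat (n + 2)
          * ((bernoulli_polynomial (n + 2) x - bernoulli_polynomial (n + 2) y) / (x - y))
    = - 2 * (\<Sum>l=0..n+1. of_nat ((n + 1) choose l)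
        * ((euler_polynomial l (x - y) * bernoulli_polynomial (n + 1 - l) y
            + euler_polynomial l (y - x) * bernoulli_polynomial (n + 1 - l) x)
           / of_nat (l + 1)))"
proof -
  have "((\<lambda>t. 4 * bernoulli_polynomial (n + 1) (y + (x - y) * of_real t)
      - 2 * (\<Sum>l=0..n+1. of_nat ((n + 1) choose l) *
            (of_real t ^ l * (euler_polynomial l (x - y) * bernoulli_polynomial (n + 1 - l) y)
             + (1 - of_real t) ^ l * (euler_polynomial l (y - x) * bernoulli_polynomial (n + 1 - l) x))))
    has_integral
      4 * ((bernoulli_polynomial (n + 1 + 1) x - bernoulli_polynomial (n + 1 + 1) y)
             / (of_nat (n + 1 + 1) * (x - y)))
      - 2 * (\<Sum>l=0..n+1. of_nat ((n + 1) choose l) *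
            (1 / of_nat (l + 1) * (euler_polynomial l (x - y) * bernoulli_polynomial (n + 1 - l) y)
             + 1 / of_nat (l + 1) * (euler_polynomial l (y - x) * bernoulli_polynomial (n + 1 - l) x))))
    {0..1}"
    by (intro has_integral_diff has_integral_add has_integral_mult_right has_integral_mult_left
          has_integral_sum has_integral_bernoulli_segment[OF assms] has_integral_power_unit
          has_integral_one_minus_power_unit finite_atLeastAtMost)
  moreover have "((\<lambda>t. 4 * bernoulli_polynomial (n + 1) (y + (x - y) * of_real t)
      - 2 * (\<Sum>l=0..n+1. of_nat ((n + 1) choose l) *
            (of_real t ^ l * (euler_polynomial l (x - y) * bernoulli_polynomial (n + 1 - l) y)
             + (1 - of_real t) ^ l * (euler_polynomial l (y - x) * bernoulli_polynomial (n + 1 - l) x))))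
    has_integral (\<Sum>k=0..n. euler_polynomial k x * euler_polynomial (n - k) y)) {0..1}"
    using has_integral_binomial_convolution[of n "\<lambda>k. euler_polynomial k x" "\<lambda>k. euler_polynomial k y"]
    unfolding euler_euler_convolution by (simp only: mult.assoc)
  ultimately have "(\<Sum>k=0..n. euler_polynomial k x * euler_polynomial (n - k) y) =
      4 * ((bernoulli_polynomial (n + 1 + 1) x - bernoulli_polynomial (n + 1 + 1) y)
             / (of_nat (n + 1 + 1) * (x - y)))
      - 2 * (\<Sum>l=0..n+1. of_nat ((n + 1) choose l) *
            (1 / of_nat (l + 1) * (euler_polynomial l (x - y) * bernoulli_polynomial (n + 1 - l) y)
             + 1 / of_nat (l + 1) * (euler_polynomial l (y - x) * bernoulli_polynomial (n + 1 - l) x)))"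
    by (rule has_integral_unique[THEN sym])
  then show ?thesis
    by (simp add: add_divide_distrib del: of_nat_Suc sum.cl_ivl_Suc)
qed

lemma bernoulli_polynomial_0: "bernoulli_polynomial 0 x = 1"
proof -
  have "fps_nth (egf (\<lambda>n. bernoulli_polynomial n 0) * (fps_exp 1 - 1)) 1
      = fps_nth (fps_X * fps_exp 0 :: complex fps) 1"
    by (simp only: egf_bernoulli)
  then have "bernoulli_polynomial 0 0 = 1"
    by (simp add: fps_mult_nth egf_def)
  then show ?thesis
    by (simp add: bernoulli_polynomial_def)
qed

text \<open>
  In the proof, \<open>R\<close> is \<open>n + 1\<close> times the right-hand side of the coefficient identity, as a function
  of \<open>t\<close>. That identity is available for \<open>t \<noteq> 0\<close> only, which suffices because a single point does
  not affect the integral.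
\<close>

lemma sum_bernoulli_euler:
  assumes "n > 0" and "x \<noteq> y"
  shows "(\<Sum>k=0..n. bernoulli_polynomial k x * euler_polynomial (n - k) y)
    = (\<Sum>l=1..n. of_nat ((n + 1) choose (l + 1))
        * (bernoulli_polynomial l (x - y) * euler_polynomial (n - l) y
           - euler_polynomial (l - 1) (y - x) / 2 * euler_polynomial (n - l) x))
      + of_nat (n + 1) * (euler_polynomial n x / (x - y) + euler_polynomial n y)
      - (euler_polynomial (n + 1) x - euler_polynomial (n + 1) y) / (x - y) ^ 2"
proof -
  obtain m where n: "n = m + 1"
    using assms(1) by (metis Suc_eq_plus1 gr0_implies_Suc)
  define P where "P l = bernoulli_polynomial l (x - y) * euler_polynomial (n - l) y" for l
  define Q where "Q l = euler_polynomial l (y - x) * euler_polynomial (m - l) x" for l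
  define R where "R t = of_nat (n + 1) *
      (t * (of_nat n * euler_polynomial m (y + (x - y) * t))
       + (\<Sum>l=0..n. of_nat (n choose l) * (t ^ l * P l))
       - of_nat n / 2 * (\<Sum>l=0..m. of_nat (m choose l) * (t * (1 - t) ^ l * Q l)))" for t
  have "((\<lambda>t. R (of_real t)) has_integral of_nat (n + 1) *
      ((euler_polynomial n x / (x - y)
        - (euler_polynomial (m + 2) x - euler_polynomial (m + 2) y)
            / (of_nat (m + 2) * (x - y) ^ 2))
       + (\<Sum>l=0..n. of_nat (n choose l) * (1 / of_nat (l + 1) * P l))
       - of_nat n / 2 * (\<Sum>l=0..m. of_nat (m choose l)
           * (1 / (of_nat (l + 1) * of_nat (l + 2)) * Q l)))) {0..1}"
    (is "(_ has_integral _ * (?A + ?B - ?C)) _")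
    unfolding R_def
    by (intro has_integral_diff has_integral_add has_integral_mult_right has_integral_mult_left
          has_integral_sum has_integral_euler_segment_weighted[OF assms(2), of m, folded n] has_integral_power_unit
          has_integral_one_minus_power_weighted_unit finite_atLeastAtMost)
  moreover have "((\<lambda>t. R (of_real t)) has_integral
      (\<Sum>k=0..n. bernoulli_polynomial k x * euler_polynomial (n - k) y)) {0..1}"
  proof (rule has_integral_spike_finite)
    show "((\<lambda>t. of_nat (n + 1) * (\<Sum>k=0..n. of_nat (n choose k) *
            (of_real t ^ k * bernoulli_polynomial k x *
             ((1 - of_real t) ^ (n - k) * euler_polynomial (n - k) y))))
          has_integral (\<Sum>k=0..n. bernoulli_polynomial k x * euler_polynomial (n - k) y)) {0..1}"
      by (rule has_integral_binomial_convolution)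
    show "finite {0 :: real}"
      by simp
    fix t :: real assume "t \<in> {0..1} - {0}"
    then have "of_real t \<noteq> (0 :: complex)"
      by simp
    then show "R (of_real t) = of_nat (n + 1) * (\<Sum>k=0..n. of_nat (n choose k) *
            (of_real t ^ k * bernoulli_polynomial k x *
             ((1 - of_real t) ^ (n - k) * euler_polynomial (n - k) y)))"
      unfolding bernoulli_euler_convolution[OF \<open>of_real t \<noteq> 0\<close>, of m, folded n] R_def P_def Q_def
      by (simp add: sum_distrib_left mult_ac flip: n)
  qed
  ultimately have "(\<Sum>k=0..n. bernoulli_polynomial k x * euler_polynomial (n - k) y)
      = of_nat (n + 1) * (?A + ?B - ?C)"
    by (rule has_integral_unique[THEN sym])
  also have "\<dots> = of_nat (n + 1) * ?A + of_nat (n + 1) * ?B - of_nat (n + 1) * ?C"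
    by (simp only: ring_distribs)
  also have "of_nat (n + 1) * ?A = of_nat (n + 1) * (euler_polynomial n x / (x - y))
      - (euler_polynomial (n + 1) x - euler_polynomial (n + 1) y) / (x - y) ^ 2"
  proof -
    have "c * (a - d / (c * w)) = c * a - d / w" if "c \<noteq> 0" for a c d w :: complex
      using that by (simp add: right_diff_distrib)
    moreover have "of_nat (m + 2) \<noteq> (0 :: complex)"
      unfolding of_nat_eq_0_iff by simp
    moreover have "n + 1 = m + 2"
      using n by simp
    ultimately show ?thesis
      by (simp only:)
  qed
  also have "of_nat (n + 1) * ?B = of_nat (n + 1) * euler_polynomial n y
      + (\<Sum>l=1..n. of_nat ((n + 1) choose (l + 1)) * P l)"
  proof -
    have "of_nat (n + 1) * (of_nat (n choose l) * (1 / of_nat (l + 1) * P l))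
        = of_nat ((n + 1) choose (l + 1)) * P l" for l
    proof -
      have "of_nat (l + 1) * of_nat ((n + 1) choose (l + 1))
          = (of_nat (n + 1) * of_nat (n choose l) :: complex)"
        using Suc_times_binomial[of l n] by (metis Suc_eq_plus1 of_nat_mult)
      moreover have "of_nat (l + 1) \<noteq> (0 :: complex)"
        unfolding of_nat_eq_0_iff by simp
      ultimately show ?thesis
        by (simp add: field_simps del: of_nat_Suc of_nat_add binomial_Suc_Suc)
    qed
    then have "of_nat (n + 1) * ?B = (\<Sum>l=0..n. of_nat ((n + 1) choose (l + 1)) * P l)"
      by (simp only: sum_distrib_left)
    also have "\<dots> = of_nat (n + 1) * P 0 + (\<Sum>l=1..n. of_nat ((n + 1) choose (l + 1)) * P l)"
      unfolding sum_split_first[of "\<lambda>l. of_nat ((n + 1) choose (l + 1)) * P l" m, folded n]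
        sum_from_1[of "\<lambda>l. of_nat ((n + 1) choose (l + 1)) * P l" m, folded n]
      by simp
    finally show ?thesis
      by (simp only: P_def bernoulli_polynomial_0 diff_zero mult_1_left)
  qed
  also have "of_nat (n + 1) * ?C
      = (\<Sum>l=1..n. of_nat ((n + 1) choose (l + 1))
          * (euler_polynomial (l - 1) (y - x) / 2 * euler_polynomial (n - l) x))"
  proof -
    have "of_nat (n + 1) * (of_nat n / 2 * (of_nat (m choose l)
            * (1 / (of_nat (l + 1) * of_nat (l + 2)) * Q l)))
        = of_nat ((m + 2) choose (l + 2)) * (Q l / 2)" for l
    proof -
      have "(l + 2) * ((m + 2) choose (l + 2)) = (m + 2) * ((m + 1) choose (l + 1))"
        using Suc_times_binomial[of "l + 1" "m + 1"] by (simp del: binomial_Suc_Suc)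
      moreover have "(l + 1) * ((m + 1) choose (l + 1)) = (m + 1) * (m choose l)"
        using Suc_times_binomial[of l m] by (simp del: binomial_Suc_Suc)
      ultimately have "(l + 1) * (l + 2) * ((m + 2) choose (l + 2)) = (m + 2) * (m + 1) * (m choose l)"
        by algebra
      then have "of_nat (l + 1) * of_nat (l + 2) * of_nat ((m + 2) choose (l + 2))
          = (of_nat (m + 2) * of_nat (m + 1) * of_nat (m choose l) :: complex)"
        by (metis of_nat_mult)
      moreover have "of_nat (l + 1) \<noteq> (0 :: complex)" "of_nat (l + 2) \<noteq> (0 :: complex)"
        unfolding of_nat_eq_0_iff by simp_all
      moreover have "n + 1 = m + 2"
        using n by simp
      ultimately show ?thesis
        unfolding \<open>n + 1 = m + 2\<close> unfolding n
        by (simp add: field_simps del: of_nat_Suc of_nat_add binomial_Suc_Suc)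
    qed
    then have "of_nat (n + 1) * ?C = (\<Sum>l=0..m. of_nat ((m + 2) choose (l + 2)) * (Q l / 2))"
      by (simp only: sum_distrib_left)
    also have "\<dots> = (\<Sum>l=1..m+1. of_nat ((m + 2) choose (l + 1))
          * (euler_polynomial (l - 1) (y - x) / 2 * euler_polynomial (m + 1 - l) x))"
      unfolding sum_from_1 by (simp add: Q_def)
    finally show ?thesis
      by (simp add: n)
  qed
  finally show ?thesis
    by (simp add: P_def right_diff_distrib sum_subtractf distrib_left del: of_nat_Suc binomial_Suc_Suc)
qed

text \<open>
  In the proof, \<open>L\<close> and \<open>R\<close> are the two sides of the coefficient identity after the contributions
  of index \<open>0\<close> to the first sum on each side have been collected on the left and everything has
  been divided by \<open>t\<close>.
\<close>

lemma sum_bernoulli_euler_divided: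
  assumes "n > 0" and "x \<noteq> y"
  shows "(\<Sum>k=1..n. bernoulli_polynomial k x / of_nat k * euler_polynomial (n - k) y)
      - harm n * euler_polynomial n y
      - (euler_polynomial n x - euler_polynomial n y) / (x - y)
    = (\<Sum>l=1..n. of_nat (n choose l)
        * (bernoulli_polynomial l (x - y) / of_nat l * euler_polynomial (n - l) y
           - euler_polynomial (l - 1) (y - x) / 2 * euler_polynomial (n - l) x))"
proof -
  obtain m where n: "n = m + 1"
    using assms(1) by (metis Suc_eq_plus1 gr0_implies_Suc)
  define P where "P l = bernoulli_polynomial l (x - y) * euler_polynomial (n - l) y" for l
  define Q where "Q l = euler_polynomial l (y - x) * euler_polynomial (m - l) x" for l
  define S where "S k = bernoulli_polynomial k x * euler_polynomial (n - k) y" for k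
  define L where "L t = (\<Sum>l=0..m. of_nat (n choose (l + 1)) * S (l + 1) * (t ^ l * (1 - t) ^ (m - l)))
      - (\<Sum>j=0..m. (1 - t) ^ j) * euler_polynomial n y" for t
  define R where "R t = of_nat n * euler_polynomial m (y + (x - y) * t)
       + (\<Sum>l=0..m. of_nat (n choose (l + 1)) * (t ^ l * P (l + 1)))
       - of_nat n / 2 * (\<Sum>l=0..m. of_nat (m choose l) * ((1 - t) ^ l * Q l))" for t
  have "((\<lambda>t. R (of_real t)) has_integral
      ((euler_polynomial n x - euler_polynomial n y) / (x - y)
       + (\<Sum>l=0..m. of_nat (n choose (l + 1)) * (1 / of_nat (l + 1) * P (l + 1)))
       - of_nat n / 2 * (\<Sum>l=0..m. of_nat (m choose l) * (1 / of_nat (l + 1) * Q l)))) {0..1}"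
    (is "(_ has_integral ?A + ?B - ?C) _")
    unfolding R_def
    by (intro has_integral_diff has_integral_add has_integral_mult_right has_integral_mult_left
          has_integral_sum has_integral_euler_segment[OF assms(2), of m, folded n] has_integral_power_unit
          has_integral_one_minus_power_unit finite_atLeastAtMost)
  moreover have "((\<lambda>t. R (of_real t)) has_integral
      (\<Sum>l=0..m. of_nat (n choose (l + 1)) * S (l + 1) * (fact l * fact (m - l) / fact (l + (m - l) + 1)))
      - (\<Sum>j=0..m. 1 / of_nat (j + 1)) * euler_polynomial n y) {0..1}"
    (is "(_ has_integral ?D - ?H * _) _")
  proof (rule has_integral_spike_finite)
    show "((\<lambda>t. L (of_real t)) has_integral ?D - ?H * euler_polynomial n y) {0..1}"
      unfolding L_def
      by (intro has_integral_diff has_integral_mult_right has_integral_mult_left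
            has_integral_sum has_integral_power_mult_power_unit
            has_integral_one_minus_power_unit finite_atLeastAtMost)
    show "finite {0 :: real}"
      by simp
    fix r :: real assume "r \<in> {0..1} - {0}"
    define t where "t = complex_of_real r"
    have "t \<noteq> 0"
      using \<open>r \<in> {0..1} - {0}\<close> by (simp add: t_def)
    have "t * L t = t * (\<Sum>l=0..m. of_nat (n choose (l + 1)) * S (l + 1) * (t ^ l * (1 - t) ^ (m - l)))
        - (t * (\<Sum>j<n. (1 - t) ^ j)) * euler_polynomial n y"
      by (simp add: L_def right_diff_distrib mult.assoc n atLeast0AtMost lessThan_Suc_atMost)
    also have "t * (\<Sum>j<n. (1 - t) ^ j) = 1 - (1 - t) ^ n"
      using one_diff_power_eq[of "1 - t" n] by simp
    also have "t * (\<Sum>l=0..m. of_nat (n choose (l + 1)) * S (l + 1) * (t ^ l * (1 - t) ^ (m - l)))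
        = (\<Sum>k=0..n. of_nat (n choose k) *
            (t ^ k * bernoulli_polynomial k x * ((1 - t) ^ (n - k) * euler_polynomial (n - k) y)))
          - (1 - t) ^ n * euler_polynomial n y"
    proof -
      have "t * (\<Sum>l=0..m. of_nat (n choose (l + 1)) * S (l + 1) * (t ^ l * (1 - t) ^ (m - l)))
          = (\<Sum>l=0..m. of_nat (n choose (l + 1)) * (t ^ (l + 1) * bernoulli_polynomial (l + 1) x *
              ((1 - t) ^ (n - (l + 1)) * euler_polynomial (n - (l + 1)) y)))"
        unfolding sum_distrib_left
        by (intro sum.cong refl) (simp add: n S_def mult_ac del: binomial_Suc_Suc)
      then show ?thesis
        using sum_split_first[of "\<lambda>k. of_nat (n choose k) * (t ^ k * bernoulli_polynomial k x *
              ((1 - t) ^ (n - k) * euler_polynomial (n - k) y))" m, folded n]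
        by (simp add: bernoulli_polynomial_0)
    qed
    also have "\<dots> - (1 - (1 - t) ^ n) * euler_polynomial n y
        = (\<Sum>k=0..n. of_nat (n choose k) *
            (t ^ k * bernoulli_polynomial k x * ((1 - t) ^ (n - k) * euler_polynomial (n - k) y)))
          - euler_polynomial n y"
      by (simp add: algebra_simps)
    also have "\<dots> = t * (of_nat n * euler_polynomial m (y + (x - y) * t))
        + ((\<Sum>l=0..n. of_nat (n choose l) * (t ^ l * P l)) - euler_polynomial n y)
        - t * (of_nat n / 2 * (\<Sum>l=0..m. of_nat (m choose l) * ((1 - t) ^ l * Q l)))"
      unfolding bernoulli_euler_convolution[OF \<open>t \<noteq> 0\<close>, of m, folded n] P_def Q_def
      by (simp add: mult.assoc)
    also have "(\<Sum>l=0..n. of_nat (n choose l) * (t ^ l * P l)) - euler_polynomial n y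
        = t * (\<Sum>l=0..m. of_nat (n choose (l + 1)) * (t ^ l * P (l + 1)))"
    proof -
      have "t * (\<Sum>l=0..m. of_nat (n choose (l + 1)) * (t ^ l * P (l + 1)))
          = (\<Sum>l=0..m. of_nat (n choose (l + 1)) * (t ^ (l + 1) * P (l + 1)))"
        unfolding sum_distrib_left
        by (intro sum.cong refl) (simp add: mult_ac del: binomial_Suc_Suc)
      moreover have "P 0 = euler_polynomial n y"
        by (simp add: P_def bernoulli_polynomial_0)
      ultimately show ?thesis
        using sum_split_first[of "\<lambda>l. of_nat (n choose l) * (t ^ l * P l)" m, folded n] by simp
    qed
    also have "t * (of_nat n * euler_polynomial m (y + (x - y) * t))
        + t * (\<Sum>l=0..m. of_nat (n choose (l + 1)) * (t ^ l * P (l + 1)))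
        - t * (of_nat n / 2 * (\<Sum>l=0..m. of_nat (m choose l) * ((1 - t) ^ l * Q l))) = t * R t"
      by (simp only: R_def ring_distribs)
    finally show "R (of_real r) = L (of_real r)"
      using \<open>t \<noteq> 0\<close> by (simp add: t_def)
  qed
  ultimately have "?D - ?H * euler_polynomial n y = ?A + ?B - ?C"
    by (rule has_integral_unique[THEN sym])
  moreover have absorb: "of_nat (l + 1) * of_nat (n choose (l + 1))
      = (of_nat n * of_nat (m choose l) :: complex)" for l
    using Suc_times_binomial[of l m] n by (metis Suc_eq_plus1 of_nat_mult)
  have nz: "of_nat (l + 1) \<noteq> (0 :: complex)" for l
    unfolding of_nat_eq_0_iff by simp
  have "?D = (\<Sum>k=1..n. bernoulli_polynomial k x / of_nat k * euler_polynomial (n - k) y)"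
  proof -
    have "of_nat (n choose (l + 1)) * S (l + 1) * (fact l * fact (m - l) / fact (l + (m - l) + 1))
        = S (l + 1) / of_nat (l + 1)" if "l \<in> {0..m}" for l
    proof -
      have le: "l \<le> m" using that by simp
      have "of_nat (n choose (l + 1)) * (fact l * fact (m - l) / fact (m + 1))
          = of_nat n / of_nat (l + 1)
              * (of_nat (m choose l) * (fact l * fact (m - l) / fact (m + 1)) :: complex)"
        using absorb[of l] nz[of l] by (simp add: field_simps del: of_nat_Suc of_nat_add binomial_Suc_Suc fact_Suc)
      also have "\<dots> = 1 / of_nat (l + 1)"
        unfolding binomial_mult_beta[OF le] using nz[of m] by (simp add: n del: of_nat_Suc of_nat_add)
      finally show ?thesis
        using le by (simp del: of_nat_Suc of_nat_add binomial_Suc_Suc fact_Suc add: field_simps)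
    qed
    then have "?D = (\<Sum>l=0..m. S (l + 1) / of_nat (l + 1))"
      by (intro sum.cong) auto
    also have "\<dots> = (\<Sum>k=1..n. S k / of_nat k)"
      using sum_from_1[of "\<lambda>k. S k / of_nat k" m, folded n] by (rule sym)
    finally show ?thesis
      by (simp add: S_def)
  qed
  moreover have "?H = harm n"
    using sum_from_1[of "\<lambda>k. 1 / of_nat k :: complex" m, folded n]
    by (simp add: harm_def inverse_eq_divide)
  moreover have "?B = (\<Sum>l=1..n. of_nat (n choose l)
        * (bernoulli_polynomial l (x - y) / of_nat l * euler_polynomial (n - l) y))"
    using sum_from_1[of "\<lambda>l. of_nat (n choose l) * (1 / of_nat l * P l)" m, folded n]
    by (simp add: P_def)
  moreover have "?C = (\<Sum>l=1..n. of_nat (n choose l)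
        * (euler_polynomial (l - 1) (y - x) / 2 * euler_polynomial (n - l) x))"
  proof -
    have "of_nat n / 2 * (of_nat (m choose l) * (1 / of_nat (l + 1) * Q l))
        = of_nat (n choose (l + 1)) * (Q l / 2)" for l
      using absorb[of l] nz[of l] by (simp add: field_simps del: of_nat_Suc of_nat_add binomial_Suc_Suc)
    then have "?C = (\<Sum>l=0..m. of_nat (n choose (l + 1)) * (Q l / 2))"
      by (simp only: sum_distrib_left)
    also have "\<dots> = (\<Sum>l=1..m+1. of_nat (n choose l)
        * (euler_polynomial (l - 1) (y - x) / 2 * euler_polynomial (m + 1 - l) x))"
      unfolding sum_from_1 by (simp add: Q_def)
    finally show ?thesis
      by (simp add: n)
  qed
  ultimately show ?thesis
    by (simp add: right_diff_distrib sum_subtractf)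
qed

theorem theorem1p2:
  fixes n :: nat and x y :: complex
  assumes "n > 0" and "x \<noteq> y"
  shows
    "((\<Sum>k=0..n. euler_polynomial k x * euler_polynomial (n - k) y)
       - 4 / of_nat (n + 2)
         * ((bernoulli_polynomial (n + 2) x - bernoulli_polynomial (n + 2) y) / (x - y))
     = - 2 * (\<Sum>l=0..n+1. of_nat ((n + 1) choose l)
         * ((euler_polynomial l (x - y) * bernoulli_polynomial (n + 1 - l) y
             + euler_polynomial l (y - x) * bernoulli_polynomial (n + 1 - l) x)
            / of_nat (l + 1))))
     \<and> ((\<Sum>k=1..n. bernoulli_polynomial k x / of_nat k * euler_polynomial (n - k) y)
       - harm n * euler_polynomial n y
       - (euler_polynomial n x - euler_polynomial n y) / (x - y)
     = (\<Sum>l=1..n. of_nat (n choose l)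
         * (bernoulli_polynomial l (x - y) / of_nat l * euler_polynomial (n - l) y
            - euler_polynomial (l - 1) (y - x) / 2 * euler_polynomial (n - l) x)))
     \<and> ((\<Sum>k=0..n. bernoulli_polynomial k x * euler_polynomial (n - k) y)
     = (\<Sum>l=1..n. of_nat ((n + 1) choose (l + 1))
         * (bernoulli_polynomial l (x - y) * euler_polynomial (n - l) y
            - euler_polynomial (l - 1) (y - x) / 2 * euler_polynomial (n - l) x))
       + of_nat (n + 1) * (euler_polynomial n x / (x - y) + euler_polynomial n y)
       - (euler_polynomial (n + 1) x - euler_polynomial (n + 1) y) / (x - y) ^ 2)"
  using sum_euler_euler[OF assms(2)] sum_bernoulli_euler_divided[OF assms]
    sum_bernoulli_euler[OF assms]
  by (intro conjI)

end
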